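(* Let $n\ge 2$, let $x_1,\dots,x_n,y$ be propositional variables and let $p_1,\dots,p_{n-1}$ be fresh propositional variables. The CNF formula $$(\neg y\vee\neg x_1\vee p_1)\wedge(\neg y\vee\neg x_n\vee\neg p_{n-1})\wedge\bigwedge_{1<i<n}\Big[(\neg y\vee\neg x_i\vee p_i)\wedge(\neg y\vee\neg p_{i-1}\vee p_i)\wedge(\neg y\vee\neg x_i\vee\neg p_{i-1})\Big],$$ obtained by adding $\neg y$ to every clause of the sequential counter encoding of $\sum_{i=1}^n x_i\le 1$, does not maintain generalized arc consistency by unit propagation for the conditional constraint $y\rightarrow\sum_{i=1}^n x_i\le 1$: assigning two of the variables $x_1,\dots,x_n$ to true does not allow $\neg y$ to be derived by unit propagation.
   Context: Unit propagation on a CNF formula repeatedly picks a unit clause $\{l\}$, deletes all clauses containing $l$ and removes the complement of $l$ from the other clauses; a literal is derived by unit propagation if it occurs as a unit clause at some stage, and a conflict is derived if the empty clause appears. For a set of literals $\rho$, unit propagation on $\mathcal F$ under $\rho$ means unit propagation on $\mathcal F\wedge\bigwedge_{l\in\rho}l$. A partial assignment of $x_1,\dots,x_n$ is a set of literals over these variables containing no complementary pair. A CNF formula $\mathcal F$ over $y,x_1,\dots,x_n$ and auxiliary variables maintains generalized arc consistency (GAC) by unit propagation for $y\rightarrow\sum_{i=1}^n x_i\le k$ if for every partial assignment $\rho$ of $x_1,\dots,x_n$: (i) (when $y$ is true, GAC is maintained on the cardinality constraint) under $\rho\cup\{y\}$: if more than $k$ of the $x_i$ are true in $\rho$, unit propagation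 on $\mathcal F$ derives a conflict; and if exactly $k$ of the $x_i$ are true in $\rho$, unit propagation derives $\neg x_j$ for every $x_j$ not assigned by $\rho$; (ii) if more than $k$ of the $x_i$ are true in $\rho$ (the cardinality constraint is false), unit propagation on $\mathcal F$ under $\rho$ derives $\neg y$. Here $k=1$. *)

theory Defs
  imports Main
begin

datatype 'v literal = Pos (var_of: 'v) | Neg (var_of: 'v)

fun negate :: "'v literal \<Rightarrow> 'v literal" where
  "negate (Pos v) = Neg v"
| "negate (Neg v) = Pos v"

type_synonym 'v clause = "'v literal set"
type_synonym 'v cnf = "'v clause set"

definition propagate :: "'v literal \<Rightarrow> 'v cnf \<Rightarrow> 'v cnf" where
  "propagate l F = {C - {negate l} | C. C \<in> F \<and> l \<notin> C}"

inductive up_step :: "'v cnf \<Rightarrow> 'v cnf \<Rightarrow> bool" where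
  "{l} \<in> F \<Longrightarrow> up_step F (propagate l F)"

text \<open>The order in which unit clauses are picked is left open: something is derived if
  some order of picks, possibly continuing after the empty clause has appeared, produces it.\<close>

definition up_derives :: "'v cnf \<Rightarrow> 'v literal \<Rightarrow> bool" where
  "up_derives F l \<longleftrightarrow> (\<exists>G. up_step\<^sup>*\<^sup>* F G \<and> {l} \<in> G)"

definition up_conflict :: "'v cnf \<Rightarrow> bool" where
  "up_conflict F \<longleftrightarrow> (\<exists>G. up_step\<^sup>*\<^sup>* F G \<and> {} \<in> G)"

definition with_units :: "'v cnf \<Rightarrow> 'v literal set \<Rightarrow> 'v cnf" where
  "with_units F \<rho> = F \<union> {{l} | l. l \<in> \<rho>}"

definition partial_assignment :: "'v set \<Rightarrow> 'v literal set \<Rightarrow> bool" where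
  "partial_assignment V \<rho> \<longleftrightarrow> var_of ` \<rho> \<subseteq> V \<and> (\<forall>l\<in>\<rho>. negate l \<notin> \<rho>)"

definition num_true :: "nat \<Rightarrow> (nat \<Rightarrow> 'v) \<Rightarrow> 'v literal set \<Rightarrow> nat" where
  "num_true n x \<rho> = card {i \<in> {1..n}. Pos (x i) \<in> \<rho>}"

text \<open>Generalized arc consistency by unit propagation for the conditional constraint
  \<open>y \<longrightarrow> x 1 + \<dots> + x n \<le> k\<close>; every other variable of \<open>F\<close> is auxiliary.\<close>

definition maintains_gac_cond_le ::
    "'v cnf \<Rightarrow> 'v \<Rightarrow> nat \<Rightarrow> (nat \<Rightarrow> 'v) \<Rightarrow> nat \<Rightarrow> bool" where
  "maintains_gac_cond_le F y n x k \<longleftrightarrow>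
    (\<forall>\<rho>. partial_assignment (x ` {1..n}) \<rho> \<longrightarrow>
      (num_true n x \<rho> > k \<longrightarrow> up_conflict (with_units F (\<rho> \<union> {Pos y}))) \<and>
      (num_true n x \<rho> = k \<longrightarrow>
        (\<forall>j\<in>{1..n}. Pos (x j) \<notin> \<rho> \<and> Neg (x j) \<notin> \<rho> \<longrightarrow>
          up_derives (with_units F (\<rho> \<union> {Pos y})) (Neg (x j)))) \<and>
      (num_true n x \<rho> > k \<longrightarrow> up_derives (with_units F \<rho>) (Neg y)))"

definition seq_counter :: "nat \<Rightarrow> (nat \<Rightarrow> 'v) \<Rightarrow> (nat \<Rightarrow> 'v) \<Rightarrow> 'v cnf" where
  "seq_counter n x p =
    {{Neg (x 1), Pos (p 1)}, {Neg (x n), Neg (p (n - 1))}} \<union>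
    (\<Union>i\<in>{1<..<n}.
      {{Neg (x i), Pos (p i)},
       {Neg (p (i - 1)), Pos (p i)},
       {Neg (x i), Neg (p (i - 1))}})"

definition cond_seq_counter :: "nat \<Rightarrow> 'v \<Rightarrow> (nat \<Rightarrow> 'v) \<Rightarrow> (nat \<Rightarrow> 'v) \<Rightarrow> 'v cnf" where
  "cond_seq_counter n y x p =
    {{Neg y, Neg (x 1), Pos (p 1)}, {Neg y, Neg (x n), Neg (p (n - 1))}} \<union>
    (\<Union>i\<in>{1<..<n}.
      {{Neg y, Neg (x i), Pos (p i)},
       {Neg y, Neg (p (i - 1)), Pos (p i)},
       {Neg y, Neg (x i), Neg (p (i - 1))}})"

lemma cond_seq_counter_eq: "cond_seq_counter n y x p = insert (Neg y) ` seq_counter n x p"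
  by (simp add: cond_seq_counter_def seq_counter_def image_Un image_UN)

end

(* Assigning the x i never propagates beyond the x i: every clause contains Neg y together with a
   literal over some p i, so it keeps at least two literals and no new unit clause arises. *)
theory Submission
  imports Defs
begin

text \<open>Every clause of the formula contains \<open>Neg y\<close> and a literal over some
  \<open>p i\<close>. Propagating literals over the \<open>x i\<close> deletes whole clauses or
  removes \<open>x i\<close> literals, so each surviving clause keeps these two literals and never
  becomes unit. Hence, by \<open>up_step_invariant\<close>, propagation under a consistent
  \<open>\<rho>\<close> over the \<open>x i\<close> derives only members of \<open>\<rho>\<close>,
  and \<open>Neg y\<close> is not one of them. Setting two of the \<open>x i\<close> to true then
  refutes the last conjunct of \<open>maintains_gac_cond_le\<close>.\<close>

lemma var_of_negate [simp]: "var_of (negate l) = var_of l"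
  by (cases l) auto

text \<open>With \<open>V\<close> the set of assigned variables, the two literals \<open>a\<close>
  and \<open>b\<close> are out of reach of propagation and keep the clause from becoming unit or
  empty.\<close>

definition two_outside :: "'v set \<Rightarrow> 'v clause \<Rightarrow> bool" where
  "two_outside V C \<longleftrightarrow>
    (\<exists>a\<in>C. \<exists>b\<in>C. a \<noteq> b \<and> var_of a \<notin> V \<and> var_of b \<notin> V)"

lemma not_two_outside_singleton [simp]: "\<not> two_outside V {l}"
  by (simp add: two_outside_def)

lemma two_outside_remove:
  assumes "two_outside V C" "var_of l \<in> V"
  shows "two_outside V (C - {l})"
  using assms unfolding two_outside_def by blast

lemma up_step_invariant:
  assumes \<rho>: "partial_assignment V \<rho>"
    and inv: "\<forall>C\<in>F. (\<exists>l\<in>\<rho>. C = {l}) \<or> two_outside V C"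
    and "up_step F G"
  shows "\<forall>C\<in>G. (\<exists>l\<in>\<rho>. C = {l}) \<or> two_outside V C"
  using \<open>up_step F G\<close>
proof cases
  case (1 l)
  \<comment> \<open>A clause with two distinct literals is not a singleton, so the picked unit comes
    from \<open>\<rho>\<close>.\<close>
  then have "l \<in> \<rho>"
    using inv by fastforce
  \<comment> \<open>The first fact protects the two outside literals; the second ensures that no
    unit clause from \<open>\<rho>\<close> is emptied.\<close>
  then have "var_of (negate l) \<in> V" and "negate l \<notin> \<rho>"
    using \<rho> by (auto simp: partial_assignment_def)
  with inv show ?thesis
    unfolding 1 propagate_def by (fastforce intro: two_outside_remove)
qed

lemma up_derives_only_assigned:
  assumes \<rho>: "partial_assignment V \<rho>"
    and F: "\<forall>C\<in>F. two_outside V C"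
    and "up_derives (with_units F \<rho>) l"
  shows "l \<in> \<rho>"
proof -
  obtain G where steps: "up_step\<^sup>*\<^sup>* (with_units F \<rho>) G" and unit: "{l} \<in> G"
    using assms(3) by (auto simp: up_derives_def)
  from steps have "\<forall>C\<in>G. (\<exists>l\<in>\<rho>. C = {l}) \<or> two_outside V C"
  proof induction
    case base
    then show ?case
      using F by (auto simp: with_units_def)
  next
    case (step G H)
    then show ?case
      using up_step_invariant[OF \<rho>] by blast
  qed
  with unit show ?thesis
    by fastforce
qed

text \<open>The two literals are \<open>Neg y\<close> and one over a counter variable
  \<open>p i\<close>; they differ because \<open>p i\<close> is not \<open>y\<close>. All counter
  indices that occur, including \<open>i - 1\<close> for \<open>1 < i < n\<close>, lie in
  \<open>{1..n - 1}\<close>.\<close>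

lemma cond_seq_counter_two_outside:
  assumes "n \<ge> 2" "y \<notin> V" "p ` {1..n - 1} \<inter> (V \<union> {y}) = {}"
    and "C \<in> cond_seq_counter n y x p"
  shows "two_outside V C"
proof -
  have p: "p i \<notin> V \<and> p i \<noteq> y" if "i \<in> {1..n - 1}" for i
    using assms(3) that by blast
  have "\<exists>l\<in>C. Neg y \<in> C \<and> (\<exists>i\<in>{1..n - 1}. var_of l = p i)"
  proof -
    consider "C = {Neg y, Neg (x 1), Pos (p 1)}" | "C = {Neg y, Neg (x n), Neg (p (n - 1))}"
      | i where "i \<in> {1<..<n}" "C = {Neg y, Neg (x i), Pos (p i)}"
      | i where "i \<in> {1<..<n}" "C = {Neg y, Neg (p (i - 1)), Pos (p i)}"
      | i where "i \<in> {1<..<n}" "C = {Neg y, Neg (x i), Neg (p (i - 1))}"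
      using assms(4) unfolding cond_seq_counter_def by blast
    then show ?thesis
    proof cases
      case 1
      then show ?thesis using \<open>n \<ge> 2\<close> by (intro bexI[of _ "Pos (p 1)"]) auto
    next
      case 2
      then show ?thesis using \<open>n \<ge> 2\<close> by (intro bexI[of _ "Neg (p (n - 1))"]) auto
    next
      case (3 i)
      then show ?thesis by (intro bexI[of _ "Pos (p i)"]) auto
    next
      case (4 i)
      then show ?thesis by (intro bexI[of _ "Pos (p i)"]) auto
    next
      case (5 i)
      then show ?thesis by (intro bexI[of _ "Neg (p (i - 1))"] conjI bexI[of _ "i - 1"]) auto
    qed
  qed
  then obtain l i where "l \<in> C" "Neg y \<in> C" "i \<in> {1..n - 1}" "var_of l = p i"
    by blast
  moreover from this have "l \<noteq> Neg y"
    using p by fastforce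
  ultimately show ?thesis
    unfolding two_outside_def using p \<open>y \<notin> V\<close> by (metis literal.sel(2))
qed

theorem mainTheorem6:
  fixes n :: nat and x p :: "nat \<Rightarrow> 'v" and y :: 'v
  assumes "n \<ge> 2"
    and "inj_on x {1..n}" and "y \<notin> x ` {1..n}"
    and "inj_on p {1..n - 1}" and "p ` {1..n - 1} \<inter> (x ` {1..n} \<union> {y}) = {}"
  shows "\<not> maintains_gac_cond_le (cond_seq_counter n y x p) y n x 1 \<and>
    (\<forall>\<rho> i j. partial_assignment (x ` {1..n}) \<rho> \<and> i \<in> {1..n} \<and> j \<in> {1..n} \<and> i \<noteq> j \<and>
       Pos (x i) \<in> \<rho> \<and> Pos (x j) \<in> \<rho> \<longrightarrow>
       \<not> up_derives (with_units (cond_seq_counter n y x p) \<rho>) (Neg y))"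
proof -
  have no_y: "\<not> up_derives (with_units (cond_seq_counter n y x p) \<rho>) (Neg y)"
    if \<rho>: "partial_assignment (x ` {1..n}) \<rho>" for \<rho>
  proof
    assume "up_derives (with_units (cond_seq_counter n y x p) \<rho>) (Neg y)"
    then have "Neg y \<in> \<rho>"
      using up_derives_only_assigned[OF \<rho>] cond_seq_counter_two_outside[OF assms(1,3,5)]
      by blast
    then have "var_of (Neg y) \<in> x ` {1..n}"
      using \<rho> unfolding partial_assignment_def by blast
    then show False
      using assms(3) by simp
  qed
  \<comment> \<open>A smallest assignment violating the bound 1; both variables exist since
    \<open>n \<ge> 2\<close>.\<close>
  let ?\<rho> = "{Pos (x 1), Pos (x 2)}"
  have \<rho>: "partial_assignment (x ` {1..n}) ?\<rho>"
    using \<open>n \<ge> 2\<close> by (auto simp: partial_assignment_def)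
  \<comment> \<open>\<open>num_true\<close> counts indices; injectivity of \<open>x\<close> rules
    out any beyond 1 and 2.\<close>
  have "{i \<in> {1..n}. Pos (x i) \<in> ?\<rho>} = {1, 2}"
    using \<open>n \<ge> 2\<close> inj_onD[OF assms(2)] by fastforce
  then have "num_true n x ?\<rho> > 1"
    by (simp add: num_true_def)
  with \<rho> no_y have "\<not> maintains_gac_cond_le (cond_seq_counter n y x p) y n x 1"
    unfolding maintains_gac_cond_le_def by blast
  with no_y show ?thesis
    by blast
qed

end
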